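(* Let $G$ be a (discrete) group. Then $G$ is supramenable if and only if for every non-empty compact Hausdorff space $X$ and every partial action of $G$ on $X$, there exists an invariant probability measure on $X$.
   Context: All groups are discrete; $e$ denotes the identity element. A group $G$ is supramenable if for every non-empty subset $A\subset G$ there is a finitely additive measure $\mu:\mathcal{P}(G)\to[0,+\infty]$ which is invariant (i.e. $\mu(gE)=\mu(E)$ for all $g\in G$, $E\subset G$) and satisfies $\mu(A)=1$. A partial action $\theta$ of a group $G$ on a topological space $X$ is a pair $(\{D_g\}_{g\in G},\{\theta_g\}_{g\in G})$, where each $D_g$ is a (possibly empty) open subset of $X$ and each $\theta_g$ is a homeomorphism from $D_{g^{-1}}$ onto $D_g$, such that: (i) $\theta_e=\mathrm{Id}_X$ (in particular $D_e=X$); (ii) for all $g,h\in G$ and $x\in D_{g^{-1}}$, if $\theta_g(x)\in D_{h^{-1}}$, then $x\in D_{(hg)^{-1}}$ and $\theta_{hg}(x)=\theta_h(\theta_g(x))$. Given such a partial action, a measure $\nu$ on the Borel $\sigma$-algebra $\mathcal{B}(X)$ is invariant if $\nu(\theta_g(E\cap D_{g^{-1}}))=\nu(E\cap D_{g^{-1}})$ for all $E\in\mathcal{B}(X)$ and $g\in G$. A probability measure on $X$ means a (countably additive) probability measure on $\mathcal{B}(X)$. *)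

theory Defs
  imports "HOL-Probability.Probability" "HOL-Algebra.Coset"
begin

definition supramenable :: "('g, 'm) monoid_scheme \<Rightarrow> bool" where
  "supramenable G \<longleftrightarrow>
     (\<forall>A. A \<subseteq> carrier G \<and> A \<noteq> {} \<longrightarrow>
       (\<exists>\<mu> :: 'g set \<Rightarrow> ennreal.
          positive (Pow (carrier G)) \<mu> \<and>
          Measure_Space.additive (Pow (carrier G)) \<mu> \<and>
          (\<forall>g\<in>carrier G. \<forall>E. E \<subseteq> carrier G \<longrightarrow> \<mu> (g <#\<^bsub>G\<^esub> E) = \<mu> E) \<and>
          \<mu> A = 1))"

text \<open>The maps \<open>\<theta> g\<close> are total functions on the point type; only their values on
  \<open>D (inv g)\<close> carry meaning.\<close>

locale partial_action = group G
  for G :: "('g, 'm) monoid_scheme" (structure) +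
  fixes X :: "'x topology" and D :: "'g \<Rightarrow> 'x set" and \<theta> :: "'g \<Rightarrow> 'x \<Rightarrow> 'x"
  assumes open_domain: "g \<in> carrier G \<Longrightarrow> openin X (D g)"
    and homeomorphic: "g \<in> carrier G \<Longrightarrow>
      homeomorphic_map (subtopology X (D (inv g))) (subtopology X (D g)) (\<theta> g)"
    and domain_one: "D \<one> = topspace X"
    and action_one: "x \<in> topspace X \<Longrightarrow> \<theta> \<one> x = x"
    and comp_domain: "\<lbrakk>g \<in> carrier G; h \<in> carrier G; x \<in> D (inv g); \<theta> g x \<in> D (inv h)\<rbrakk>
      \<Longrightarrow> x \<in> D (inv (h \<otimes> g))"
    and comp_action: "\<lbrakk>g \<in> carrier G; h \<in> carrier G; x \<in> D (inv g); \<theta> g x \<in> D (inv h)\<rbrakk>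
      \<Longrightarrow> \<theta> (h \<otimes> g) x = \<theta> h (\<theta> g x)"

definition borel_of_topology :: "'x topology \<Rightarrow> 'x measure" where
  "borel_of_topology X = sigma (topspace X) {U. openin X U}"

definition invariant_measure ::
  "('g, 'm) monoid_scheme \<Rightarrow> ('g \<Rightarrow> 'x set) \<Rightarrow> ('g \<Rightarrow> 'x \<Rightarrow> 'x) \<Rightarrow> 'x measure \<Rightarrow> bool" where
  "invariant_measure G D \<theta> \<nu> \<longleftrightarrow>
     (\<forall>g\<in>carrier G. \<forall>E\<in>sets \<nu>.
        emeasure \<nu> (\<theta> g ` (E \<inter> D (inv\<^bsub>G\<^esub> g))) = emeasure \<nu> (E \<inter> D (inv\<^bsub>G\<^esub> g)))"

text \<open>A formula of HOL cannot quantify over all point types, so the property is stated one space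
  at a time. A characterisation of supramenability by this property for all non-empty compact
  Hausdorff spaces is an equivalence for the spaces whose points are sets of subsets of the group
  (a type that contains all ultrafilters on the group), together with the implication from
  supramenability for spaces over an arbitrary point type.\<close>

definition partial_actions_have_invariant_prob ::
  "('g, 'm) monoid_scheme \<Rightarrow> 'x topology \<Rightarrow> bool" where
  "partial_actions_have_invariant_prob G X \<longleftrightarrow>
     (\<forall>D \<theta>. partial_action G X D \<theta> \<longrightarrow>
       (\<exists>\<nu>. sets \<nu> = sets (borel_of_topology X) \<and> prob_space \<nu> \<and> invariant_measure G D \<theta> \<nu>))"

end

theory Submission
  imports Defs
begin

text \<open>Given a partial action on a compact Hausdorff space and a point \<open>x\<close>, let \<open>A\<close> be the set of
  group elements whose action is defined at \<open>x\<close>. A finitely additive invariant measure normalised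
  at \<open>A\<close> is pushed forward along the orbit map to a finitely additive, partially invariant
  probability on all subsets of the space. Its inner values on closed sets, followed by outer
  approximation by open sets, give a Borel probability by Caratheodory's theorem, and invariance
  survives because the partial homeomorphisms preserve compact and open sets.

  Conversely, the translation action on a non-empty \<open>A\<close> extends to a partial action on the
  ultrafilters on \<open>A\<close>. An invariant probability measures the clopen sets of ultrafilters, which
  yields a partially invariant finitely additive probability on the subsets of \<open>A\<close>. It extends to
  all subsets \<open>E\<close> of the group as the supremum of the total mass of finitely many disjoint pieces of
  \<open>E\<close> that are translated into \<open>A\<close>.\<close>

subsection \<open>Borel measures from finitely additive set functions\<close>

text \<open>The supremum runs over closed sets, which are compact when \<open>X\<close> is. This is
  what later turns finite additivity of \<open>m\<close> into countable subadditivity.\<close>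

definition inner_content :: "'x topology \<Rightarrow> ('x set \<Rightarrow> ennreal) \<Rightarrow> 'x set \<Rightarrow> ennreal" where
  "inner_content X m U = (SUP K\<in>{K. closedin X K \<and> K \<subseteq> U}. m K)"

definition outer_content :: "'x topology \<Rightarrow> ('x set \<Rightarrow> ennreal) \<Rightarrow> 'x set \<Rightarrow> ennreal" where
  "outer_content X m E = (INF U\<in>{U. openin X U \<and> E \<subseteq> U}. inner_content X m U)"

lemma sets_borel_of_topology:
  "sets (borel_of_topology X) = sigma_sets (topspace X) {U. openin X U}"
  unfolding borel_of_topology_def by (rule sets_measure_of) (auto dest: openin_subset)

lemma space_borel_of_topology: "space (borel_of_topology X) = topspace X"
  unfolding borel_of_topology_def by (rule space_measure_of) (auto dest: openin_subset)

lemma inner_content_mono: "U \<subseteq> V \<Longrightarrow> inner_content X m U \<le> inner_content X m V"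
  unfolding inner_content_def by (rule SUP_subset_mono) auto

lemma inner_content_upper: "closedin X K \<Longrightarrow> K \<subseteq> U \<Longrightarrow> m K \<le> inner_content X m U"
  unfolding inner_content_def by (rule SUP_upper) auto

text \<open>Adding a constant commutes with a supremum over a non-empty index set, and the empty set
  is always an admissible \<open>K\<close>. Bounds for a sum can thus be checked one closed set at a
  time.\<close>

lemma inner_content_add_le:
  assumes "\<And>K. closedin X K \<Longrightarrow> K \<subseteq> U \<Longrightarrow> m K + c \<le> d"
  shows "inner_content X m U + c \<le> d"
proof -
  have "inner_content X m U + c = (SUP K\<in>{K. closedin X K \<and> K \<subseteq> U}. m K + c)"
    unfolding inner_content_def by (rule ennreal_SUP_add_left[symmetric]) auto
  also have "\<dots> \<le> d" using assms by (intro SUP_least) auto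
  finally show ?thesis .
qed

lemma outer_content_lower: "openin X U \<Longrightarrow> E \<subseteq> U \<Longrightarrow> outer_content X m E \<le> inner_content X m U"
  unfolding outer_content_def by (rule INF_lower) auto

lemma outer_content_mono: "E \<subseteq> F \<Longrightarrow> outer_content X m E \<le> outer_content X m F"
  unfolding outer_content_def by (rule INF_superset_mono) auto

lemma outer_content_open:
  assumes "openin X U" shows "outer_content X m U = inner_content X m U"
  unfolding outer_content_def using assms
  by (intro antisym INF_lower INF_greatest inner_content_mono) auto

locale compact_additive =
  fixes X :: "'x topology" and m :: "'x set \<Rightarrow> ennreal"
  assumes compact: "compact_space X" and Hausdorff: "Hausdorff_space X"
    and positive: "positive (Pow (topspace X)) m"
    and additive: "Measure_Space.additive (Pow (topspace X)) m"
begin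

lemma m_mono:
  assumes "E \<subseteq> F" "F \<subseteq> topspace X" shows "m E \<le> m F"
proof -
  interpret S: sigma_algebra "topspace X" "Pow (topspace X)" by (rule sigma_algebra_Pow)
  show ?thesis
    using increasingD[OF S.additive_increasing[OF positive additive]] assms by auto
qed

lemma m_union_le:
  assumes "E \<subseteq> topspace X" "F \<subseteq> topspace X" shows "m (E \<union> F) \<le> m E + m F"
proof -
  have "m (E \<union> F) = m (E \<union> (F - E))" by simp
  also have "\<dots> = m E + m (F - E)"
    using assms additiveD[OF additive, of E "F - E"] by auto
  also have "\<dots> \<le> m E + m F"
    using assms by (intro add_left_mono m_mono) auto
  finally show ?thesis .
qed

section \<open>Subadditivity of the inner and outer contents\<close>

lemma inner_content_empty: "inner_content X m {} = 0"
proof -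
  have "{K. closedin X K \<and> K \<subseteq> {}} = {{}}" by auto
  then show ?thesis using positive by (simp add: inner_content_def positive_def)
qed

lemma outer_content_empty: "outer_content X m {} = 0"
  by (simp add: outer_content_open inner_content_empty)

text \<open>Normality separates the disjoint closed sets \<open>K - U\<close> and
  \<open>K - V\<close> by open \<open>S\<close> and \<open>T\<close>. Removing \<open>S\<close> and
  \<open>T\<close> in turn writes \<open>K\<close> as a union of a closed subset of \<open>U\<close>
  and a closed subset of \<open>V\<close>.\<close>

lemma inner_content_union_le:
  assumes "openin X U" "openin X V"
  shows "inner_content X m (U \<union> V) \<le> inner_content X m U + inner_content X m V"
  unfolding inner_content_def[of X m "U \<union> V"]
proof (rule SUP_least)
  fix K assume "K \<in> {K. closedin X K \<and> K \<subseteq> U \<union> V}"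
  then have K: "closedin X K" "K \<subseteq> U \<union> V" by auto
  have "normal_space X"
    using compact Hausdorff compact_Hausdorff_or_regular_imp_normal_space by blast
  moreover have "closedin X (K - U)" "closedin X (K - V)" "disjnt (K - U) (K - V)"
    using K assms by (auto intro: closedin_diff simp: disjnt_def)
  ultimately obtain S T where ST: "openin X S" "openin X T" "K - U \<subseteq> S" "K - V \<subseteq> T" "disjnt S T"
    unfolding normal_space_def by meson
  have c: "closedin X (K - S)" "closedin X (K - T)" "K - S \<subseteq> U" "K - T \<subseteq> V"
    using K ST by (auto intro: closedin_diff)
  have "K = (K - S) \<union> (K - T)" using ST(5) by (auto simp: disjnt_def)
  then have "m K \<le> m (K - S) + m (K - T)"
    using m_union_le[of "K - S" "K - T"] closedin_subset[OF K(1)] by auto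
  also have "\<dots> \<le> inner_content X m U + inner_content X m V"
    by (intro add_mono inner_content_upper c)
  finally show "m K \<le> inner_content X m U + inner_content X m V" .
qed

lemma inner_content_finite_Union_le:
  assumes "finite I" "\<And>i. i \<in> I \<Longrightarrow> openin X (U i)"
  shows "inner_content X m (\<Union>i\<in>I. U i) \<le> (\<Sum>i\<in>I. inner_content X m (U i))"
  using assms
proof (induction I)
  case empty
  then show ?case by (simp add: inner_content_empty)
next
  case (insert i I)
  have "inner_content X m (\<Union>i\<in>insert i I. U i)
      \<le> inner_content X m (U i) + inner_content X m (\<Union>i\<in>I. U i)"
    using insert.prems by (auto intro!: inner_content_union_le)
  also have "\<dots> \<le> inner_content X m (U i) + (\<Sum>i\<in>I. inner_content X m (U i))"
    using insert by (intro add_left_mono) auto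
  finally show ?case using insert by simp
qed

text \<open>A closed subset of the union is compact, so finitely many of the \<open>U i\<close>
  cover it and finite subadditivity suffices.\<close>

lemma inner_content_countable_Union_le:
  fixes U :: "nat \<Rightarrow> 'x set"
  assumes "\<And>i. openin X (U i)"
  shows "inner_content X m (\<Union>i. U i) \<le> (\<Sum>i. inner_content X m (U i))"
  unfolding inner_content_def[of X m "\<Union>i. U i"]
proof (rule SUP_least)
  fix K assume "K \<in> {K. closedin X K \<and> K \<subseteq> (\<Union>i. U i)}"
  then have K: "closedin X K" "K \<subseteq> (\<Union>i. U i)" by auto
  then have "compactin X K" using compact closedin_compact_space by blast
  then obtain \<F> where "finite \<F>" "\<F> \<subseteq> range U" "K \<subseteq> \<Union>\<F>"
    using compactinD[of X K "range U"] assms K by auto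
  then obtain I where I: "finite I" "K \<subseteq> (\<Union>i\<in>I. U i)"
    by (metis finite_subset_image)
  have "m K \<le> inner_content X m (\<Union>i\<in>I. U i)" by (intro inner_content_upper K I)
  also have "\<dots> \<le> (\<Sum>i\<in>I. inner_content X m (U i))"
    using I assms by (intro inner_content_finite_Union_le)
  also have "\<dots> \<le> (\<Sum>i. inner_content X m (U i))"
    by (intro sum_le_suminf I) auto
  finally show "m K \<le> (\<Sum>i. inner_content X m (U i))" .
qed

lemma outer_content_countable_Union_le:
  fixes E :: "nat \<Rightarrow> 'x set"
  shows "outer_content X m (\<Union>i. E i) \<le> (\<Sum>i. outer_content X m (E i))"
proof (rule ennreal_le_epsilon)
  fix e :: real assume fin: "(\<Sum>i. outer_content X m (E i)) < Orderings.top" and e: "0 < e"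
  \<comment> \<open>The tolerances \<open>e * (1/2)^Suc i\<close> add up to exactly
    \<open>e\<close>. Since the sum of the outer contents is finite here, no summand is infinite and
    each infimum can be approximated.\<close>
  have "\<exists>U. openin X U \<and> E i \<subseteq> U \<and>
      inner_content X m U < outer_content X m (E i) + ennreal (e * (1/2)^Suc i)" for i
  proof -
    have "outer_content X m (E i) \<noteq> \<infinity>"
      using ennreal_suminf_lessD[OF fin, of i] by auto
    from INF_approx_ennreal[OF _ outer_content_def this, of "e * (1/2)^Suc i"] e
    show ?thesis by auto
  qed
  then obtain U where U: "\<And>i. openin X (U i)" "\<And>i. E i \<subseteq> U i"
    "\<And>i. inner_content X m (U i) < outer_content X m (E i) + ennreal (e * (1/2)^Suc i)"
    by metis
  have "outer_content X m (\<Union>i. E i) \<le> inner_content X m (\<Union>i. U i)"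
    using U by (intro outer_content_lower) auto
  also have "\<dots> \<le> (\<Sum>i. inner_content X m (U i))"
    by (intro inner_content_countable_Union_le U)
  also have "\<dots> \<le> (\<Sum>i. outer_content X m (E i) + ennreal (e * (1/2)^Suc i))"
    using U(3) by (intro suminf_le) (auto intro: less_imp_le)
  also have "\<dots> = (\<Sum>i. outer_content X m (E i)) + (\<Sum>i. ennreal (e * (1/2)^Suc i))"
    by (intro suminf_add[symmetric]) auto
  also have "(\<Sum>i. ennreal (e * (1/2)^Suc i)) = ennreal e"
    using e sums_mult[OF power_half_series, of e]
    by (intro sums_unique[symmetric]) (simp add: sums_ennreal)
  finally show "outer_content X m (\<Union>i. E i) \<le> (\<Sum>i. outer_content X m (E i)) + ennreal e" .
qed

lemma outer_content_outer_measure_space: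
  "outer_measure_space (Pow (topspace X)) (outer_content X m)"
  unfolding outer_measure_space_def
  by (auto simp: positive_def increasing_def countably_subadditive_def outer_content_empty
      intro: outer_content_mono outer_content_countable_Union_le)

lemma outer_content_union_le:
  "outer_content X m (E \<union> F) \<le> outer_content X m E + outer_content X m F"
proof -
  have "(\<Union>i. binaryset E F i) = E \<union> F" by (rule UN_binaryset_eq)
  moreover have "(\<Sum>i. outer_content X m (binaryset E F i)) = outer_content X m E + outer_content X m F"
    by (rule suminf_binaryset_eq) (rule outer_content_empty)
  ultimately show ?thesis using outer_content_countable_Union_le[of "binaryset E F"] by simp
qed

text \<open>Fix a closed \<open>K\<close> in \<open>V \<inter> U\<close>. Then \<open>V - K\<close>
  is open and contains \<open>V - U\<close>, and each closed \<open>L\<close> inside it is disjoint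
  from \<open>K\<close>, so that \<open>m L + m K\<close> is the value of \<open>m\<close> on a
  closed subset of \<open>V\<close>.\<close>

lemma inner_content_split:
  assumes U: "openin X U" and V: "openin X V"
  shows "inner_content X m (V \<inter> U) + outer_content X m (V - U) \<le> inner_content X m V"
proof (rule inner_content_add_le)
  fix K assume K: "closedin X K" "K \<subseteq> V \<inter> U"
  have VK: "openin X (V - K)" using V K by auto
  have "outer_content X m (V - U) \<le> inner_content X m (V - K)"
    using VK K by (intro outer_content_lower) auto
  then have "m K + outer_content X m (V - U) \<le> inner_content X m (V - K) + m K"
    by (simp add: add.commute add_left_mono)
  also have "\<dots> \<le> inner_content X m V"
  proof (rule inner_content_add_le)
    fix L assume L: "closedin X L" "L \<subseteq> V - K"
    have "m L + m K = m (L \<union> K)"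
      using L(2) closedin_subset[OF L(1)] closedin_subset[OF K(1)]
      by (intro additiveD[OF additive, symmetric]) auto
    also have "\<dots> \<le> inner_content X m V"
      using L K by (intro inner_content_upper) auto
    finally show "m L + m K \<le> inner_content X m V" .
  qed
  finally show "m K + outer_content X m (V - U) \<le> inner_content X m V" .
qed

text \<open>The split inequality holds for every open \<open>V\<close> containing \<open>E\<close>,
  and the infimum over \<open>V\<close> gives the hard half of Caratheodory's criterion. The other
  half is subadditivity.\<close>

lemma open_in_lambda_system:
  assumes U: "openin X U"
  shows "U \<in> lambda_system (topspace X) (Pow (topspace X)) (outer_content X m)"
proof -
  interpret S: sigma_algebra "topspace X" "Pow (topspace X)" by (rule sigma_algebra_Pow)
  have "outer_content X m (E \<inter> U) + outer_content X m (E - U) = outer_content X m E" for E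
  proof (rule antisym)
    show "outer_content X m (E \<inter> U) + outer_content X m (E - U) \<le> outer_content X m E"
      unfolding outer_content_def[of X m E]
    proof (rule INF_greatest)
      fix V assume "V \<in> {V. openin X V \<and> E \<subseteq> V}"
      then have V: "openin X V" "E \<subseteq> V" by auto
      have "outer_content X m (E \<inter> U) + outer_content X m (E - U)
          \<le> inner_content X m (V \<inter> U) + outer_content X m (V - U)"
        using U V by (intro add_mono outer_content_lower outer_content_mono) auto
      also have "\<dots> \<le> inner_content X m V" by (rule inner_content_split[OF U V(1)])
      finally show "outer_content X m (E \<inter> U) + outer_content X m (E - U) \<le> inner_content X m V" .
    qed
    show "outer_content X m E \<le> outer_content X m (E \<inter> U) + outer_content X m (E - U)"
      using outer_content_union_le[of "E \<inter> U" "E - U"] by (simp add: Int_Diff_Un)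
  qed
  then show ?thesis using openin_subset[OF U] by (simp add: S.lambda_system_eq)
qed

section \<open>The Borel measure with the outer content as values\<close>

definition content_measure :: "'x measure" where
  "content_measure = measure_of (topspace X) {U. openin X U} (outer_content X m)"

lemma sets_content_measure: "sets content_measure = sets (borel_of_topology X)"
  unfolding content_measure_def sets_borel_of_topology
  by (rule sets_measure_of) (auto dest: openin_subset)

text \<open>Caratheodory's lemma makes the outer content a measure on the lambda system. That
  sigma-algebra contains the open sets, hence all Borel sets, and countable additivity restricts to
  them.\<close>

lemma emeasure_content_measure:
  assumes "E \<in> sets (borel_of_topology X)"
  shows "emeasure content_measure E = outer_content X m E"
proof -
  interpret S: sigma_algebra "topspace X" "Pow (topspace X)" by (rule sigma_algebra_Pow)
  let ?L = "lambda_system (topspace X) (Pow (topspace X)) (outer_content X m)"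
  let ?B = "sigma_sets (topspace X) {U. openin X U}"
  have L: "measure_space (topspace X) ?L (outer_content X m)"
    by (rule S.caratheodory_lemma) (rule outer_content_outer_measure_space)
  then interpret L: sigma_algebra "topspace X" ?L by (simp add: measure_space_def)
  have "?B \<subseteq> ?L"
    by (rule L.sigma_sets_subset) (auto intro: open_in_lambda_system)
  then have "measure_space (topspace X) ?B (outer_content X m)"
    using L sigma_algebra_sigma_sets[of "{U. openin X U}" "topspace X"] openin_subset
    unfolding measure_space_def positive_def countably_additive_def
    by (auto simp: subset_eq)
  then have "positive (sets content_measure) (outer_content X m)"
    "countably_additive (sets content_measure) (outer_content X m)"
    by (simp_all add: sets_content_measure sets_borel_of_topology measure_space_def)
  then show ?thesis
    using assms openin_subset
    by (intro emeasure_measure_of[OF content_measure_def]) (auto simp: sets_content_measure)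
qed

text \<open>The whole space is both open and closed, so neither the inner nor the outer
  approximation changes its mass.\<close>

lemma emeasure_content_measure_space:
  "emeasure content_measure (topspace X) = m (topspace X)"
proof -
  have "emeasure content_measure (topspace X) = inner_content X m (topspace X)"
    by (subst emeasure_content_measure)
      (auto simp: sets_borel_of_topology outer_content_open intro: sigma_sets_top)
  also have "\<dots> = m (topspace X)"
    unfolding inner_content_def
    by (intro antisym SUP_least SUP_upper) (auto intro: m_mono)
  finally show ?thesis .
qed

end

subsection \<open>Invariance under partial actions\<close>

context partial_action
begin

lemma domain_subset: "g \<in> carrier G \<Longrightarrow> D g \<subseteq> topspace X"
  by (intro openin_subset open_domain)

lemma action_image: "g \<in> carrier G \<Longrightarrow> \<theta> g ` D (inv g) = D g"
  using homeomorphic_imp_surjective_map[OF homeomorphic[of g]] domain_subset[of g] domain_subset[of "inv g"]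
  by (simp add: Int_absorb1)

text \<open>The point \<open>\<theta> g x\<close> lies in \<open>D g\<close>, which is the domain of
  \<open>\<theta> (inv g)\<close>, so the composition law applies to \<open>g\<close> followed by
  \<open>inv g\<close>.\<close>

lemma action_inverse:
  assumes "g \<in> carrier G" "x \<in> D (inv g)" shows "\<theta> (inv g) (\<theta> g x) = x"
proof -
  have "\<theta> g x \<in> D (inv (inv g))" using assms action_image by auto
  then have "\<theta> (inv g \<otimes> g) x = \<theta> (inv g) (\<theta> g x)"
    using assms by (intro comp_action) auto
  then show ?thesis using assms domain_subset[of "inv g"] action_one by auto
qed

lemma action_inverse_image:
  assumes "g \<in> carrier G" "E \<subseteq> D (inv g)" shows "\<theta> (inv g) ` \<theta> g ` E = E"
  using action_inverse[OF assms(1)] assms(2) by (force simp: image_image)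

lemma action_image_subset:
  assumes "g \<in> carrier G" "E \<subseteq> D (inv g)" shows "\<theta> g ` E \<subseteq> D g"
  using action_image assms by blast

lemma open_action_image:
  assumes g: "g \<in> carrier G" and U: "openin X U" "U \<subseteq> D (inv g)"
  shows "openin X (\<theta> g ` U)"
proof -
  have "openin (subtopology X (D (inv g))) U"
    using U by (simp add: openin_open_subtopology open_domain g)
  then have "openin (subtopology X (D g)) (\<theta> g ` U)"
    using homeomorphic_imp_open_map[OF homeomorphic[OF g]] by (simp add: open_map_def)
  then show ?thesis using open_domain[OF g] openin_trans_full by blast
qed

text \<open>A homeomorphism between open subspaces need not preserve closedness in \<open>X\<close>.
  A closed subset of the domain is compact, however, and its compact image is closed in a Hausdorff
  space.\<close>

lemma closed_action_image:
  assumes "compact_space X" "Hausdorff_space X"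
    and g: "g \<in> carrier G" and K: "closedin X K" "K \<subseteq> D (inv g)"
  shows "closedin X (\<theta> g ` K)"
proof -
  have "compactin (subtopology X (D (inv g))) K"
    using assms closedin_compact_space by (auto simp: compactin_subtopology)
  then have "compactin (subtopology X (D g)) (\<theta> g ` K)"
    using homeomorphic_imp_continuous_map[OF homeomorphic[OF g]] image_compactin by blast
  then show ?thesis
    using assms(2) compactin_imp_closedin by (auto simp: compactin_subtopology)
qed

text \<open>Induction on the generation of Borel sets. The complement case rests on injectivity:
  removing a set from the domain removes its image from \<open>D g\<close>.\<close>

lemma borel_action_image:
  assumes g: "g \<in> carrier G" and E: "E \<in> sets (borel_of_topology X)"
  shows "\<theta> g ` (E \<inter> D (inv g)) \<in> sets (borel_of_topology X)"
proof -
  interpret S: sigma_algebra "topspace X" "sigma_sets (topspace X) {U. openin X U}"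
    by (rule sigma_algebra_sigma_sets) (auto dest: openin_subset)
  have inj: "inj_on (\<theta> g) (D (inv g))"
    using action_inverse[OF g] by (rule inj_on_inverseI)
  from E show ?thesis unfolding sets_borel_of_topology
  proof induction
    case (Basic U)
    then show ?case using g open_domain[of "inv g"]
      by (intro sigma_sets.Basic) (auto intro: open_action_image)
  next
    case Empty
    then show ?case by (simp add: sigma_sets.Empty)
  next
    case (Compl E)
    have "(topspace X - E) \<inter> D (inv g) = D (inv g) - E \<inter> D (inv g)"
      using domain_subset[of "inv g"] g by auto
    then have "\<theta> g ` ((topspace X - E) \<inter> D (inv g)) = D g - \<theta> g ` (E \<inter> D (inv g))"
      using inj_on_image_set_diff[OF inj, of "D (inv g)" "E \<inter> D (inv g)"] action_image[OF g] by auto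
    moreover have "D g \<in> sigma_sets (topspace X) {U. openin X U}"
      using open_domain[OF g] by (auto intro: sigma_sets.Basic)
    ultimately show ?case using Compl.IH by auto
  next
    case (Union E)
    have "\<theta> g ` (\<Union> (range E) \<inter> D (inv g)) = (\<Union>i. \<theta> g ` (E i \<inter> D (inv g)))" by auto
    then show ?case using Union.IH by (auto intro: sigma_sets.Union)
  qed
qed

end

section \<open>Invariance passes from the content to the measure\<close>

locale invariant_content = partial_action G X D \<theta> + compact_additive X m
  for G :: "('g, 'm) monoid_scheme" (structure) and X :: "'x topology" and D \<theta> m +
  assumes content_invariant: "g \<in> carrier G \<Longrightarrow> E \<subseteq> D (inv g) \<Longrightarrow> m (\<theta> g ` E) = m E"
begin

text \<open>Closed subsets of \<open>U\<close> go to closed subsets of the image with the same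
  content. The reverse inequality will be this one applied to \<open>inv g\<close>.\<close>

lemma inner_content_action_le:
  assumes g: "g \<in> carrier G" and U: "U \<subseteq> D (inv g)"
  shows "inner_content X m U \<le> inner_content X m (\<theta> g ` U)"
  unfolding inner_content_def[of X m U]
proof (rule SUP_least)
  fix K assume "K \<in> {K. closedin X K \<and> K \<subseteq> U}"
  then have K: "closedin X K" "K \<subseteq> U" by auto
  then have "closedin X (\<theta> g ` K)"
    using U by (intro closed_action_image compact Hausdorff g) auto
  then have "m (\<theta> g ` K) \<le> inner_content X m (\<theta> g ` U)"
    using K by (intro inner_content_upper) auto
  then show "m K \<le> inner_content X m (\<theta> g ` U)"
    using content_invariant[OF g, of K] K U by auto
qed

lemma inner_content_action:
  assumes g: "g \<in> carrier G" and U: "U \<subseteq> D (inv g)"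
  shows "inner_content X m (\<theta> g ` U) = inner_content X m U"
  using inner_content_action_le[OF g U] inner_content_action_le[of "inv g" "\<theta> g ` U"]
    action_inverse_image[OF g U] action_image_subset[OF g U] g by simp

lemma outer_content_action_le:
  assumes g: "g \<in> carrier G" and E: "E \<subseteq> D (inv g)"
  shows "outer_content X m (\<theta> g ` E) \<le> outer_content X m E"
  unfolding outer_content_def[of X m E]
proof (rule INF_greatest)
  fix U assume "U \<in> {U. openin X U \<and> E \<subseteq> U}"
  then have U: "openin X U" "E \<subseteq> U" by auto
  \<comment> \<open>An open \<open>U\<close> around \<open>E\<close> may leave the domain of
    \<open>\<theta> g\<close>; cutting it down to the open domain keeps it open and keeps
    \<open>E\<close> inside.\<close>
  have "outer_content X m (\<theta> g ` E) \<le> inner_content X m (\<theta> g ` (U \<inter> D (inv g)))"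
    using U E g open_domain by (intro outer_content_lower open_action_image) auto
  also have "\<dots> = inner_content X m (U \<inter> D (inv g))"
    by (intro inner_content_action g) auto
  also have "\<dots> \<le> inner_content X m U" by (intro inner_content_mono) auto
  finally show "outer_content X m (\<theta> g ` E) \<le> inner_content X m U" .
qed

lemma outer_content_action:
  assumes g: "g \<in> carrier G" and E: "E \<subseteq> D (inv g)"
  shows "outer_content X m (\<theta> g ` E) = outer_content X m E"
  using outer_content_action_le[OF g E] outer_content_action_le[of "inv g" "\<theta> g ` E"]
    action_inverse_image[OF g E] action_image_subset[OF g E] g by simp

lemma invariant_content_measure: "invariant_measure G D \<theta> content_measure"
  unfolding invariant_measure_def sets_content_measure
proof (intro ballI)
  fix g E assume g: "g \<in> carrier G" and E: "E \<in> sets (borel_of_topology X)"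
  have "D (inv g) \<in> sets (borel_of_topology X)"
    using open_domain[of "inv g"] g by (auto simp: sets_borel_of_topology)
  with E have "E \<inter> D (inv g) \<in> sets (borel_of_topology X)" by auto
  then show "emeasure content_measure (\<theta> g ` (E \<inter> D (inv g)))
      = emeasure content_measure (E \<inter> D (inv g))"
    using borel_action_image[OF g E] g
    by (simp add: emeasure_content_measure outer_content_action)
qed

end

section \<open>From supramenability to invariant probabilities\<close>

lemma supramenable_imp_invariant_prob:
  fixes G :: "('g, 'm) monoid_scheme" and X :: "'x topology"
  assumes "supramenable G" and "compact_space X" "Hausdorff_space X" and "topspace X \<noteq> {}"
  shows "partial_actions_have_invariant_prob G X"
  unfolding partial_actions_have_invariant_prob_def
proof (intro allI impI)
  fix D \<theta> assume "partial_action G X D \<theta>"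
  then interpret partial_action G X D \<theta> .
  obtain x where x: "x \<in> topspace X" using assms by blast
  \<comment> \<open>\<open>\<theta> h\<close> has domain \<open>D (inv h)\<close>, so these are the
    \<open>h\<close> for which \<open>\<theta> h x\<close> is meaningful. The identity is one of
    them, so supramenability applies to \<open>A\<close>.\<close>
  define A where "A = {h \<in> carrier G. x \<in> D (inv\<^bsub>G\<^esub> h)}"
  have "\<one>\<^bsub>G\<^esub> \<in> A" using x domain_one by (simp add: A_def)
  moreover have "A \<subseteq> carrier G" by (auto simp: A_def)
  ultimately obtain \<mu> :: "'g set \<Rightarrow> ennreal" where \<mu>: "positive (Pow (carrier G)) \<mu>"
    "Measure_Space.additive (Pow (carrier G)) \<mu>"
    "\<And>g E. g \<in> carrier G \<Longrightarrow> E \<subseteq> carrier G \<Longrightarrow> \<mu> (g <#\<^bsub>G\<^esub> E) = \<mu> E" "\<mu> A = 1"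
    using assms(1) unfolding supramenable_def by (metis empty_iff)
  define m where "m E = \<mu> {h \<in> A. \<theta> h x \<in> E}" for E
  have orbit: "\<theta> h x \<in> D h" if "h \<in> A" for h
    using that action_image[of h] by (auto simp: A_def)
  \<comment> \<open>The orbit map turns left multiplication by \<open>g\<close> into
    \<open>\<theta> g\<close>, wherever \<open>\<theta> g\<close> is defined at the orbit
    point.\<close>
  have step: "g \<otimes>\<^bsub>G\<^esub> h \<in> A \<and> \<theta> (g \<otimes>\<^bsub>G\<^esub> h) x = \<theta> g (\<theta> h x)"
    if "g \<in> carrier G" "h \<in> A" "\<theta> h x \<in> D (inv\<^bsub>G\<^esub> g)" for g h
    using that comp_domain[of h g x] comp_action[of h g x] by (auto simp: A_def)
  interpret invariant_content G X D \<theta> m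
  proof
    show "positive (Pow (topspace X)) m" using \<mu>(1) by (simp add: positive_def m_def)
    show "Measure_Space.additive (Pow (topspace X)) m"
      unfolding additive_def
    proof (intro ballI impI)
      fix E F assume "E \<in> Pow (topspace X)" "F \<in> Pow (topspace X)" "E \<inter> F = {}"
      moreover have "{h \<in> A. \<theta> h x \<in> E \<union> F} = {h \<in> A. \<theta> h x \<in> E} \<union> {h \<in> A. \<theta> h x \<in> F}" by auto
      ultimately show "m (E \<union> F) = m E + m F"
        unfolding m_def using additiveD[OF \<mu>(2), of "{h \<in> A. \<theta> h x \<in> E}" "{h \<in> A. \<theta> h x \<in> F}"]
        by (auto simp: A_def)
    qed
    fix g E assume g: "g \<in> carrier G" and E: "E \<subseteq> D (inv\<^bsub>G\<^esub> g)"
    \<comment> \<open>Preimages under the orbit map of \<open>E\<close> and of its image differ by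
      left translation by \<open>g\<close>, so invariance of \<open>\<mu>\<close> becomes partial
      invariance of \<open>m\<close>. For the first inclusion \<open>inv g \<otimes> k\<close> is
      the element that is translated to \<open>k\<close>.\<close>
    have "{h \<in> A. \<theta> h x \<in> \<theta> g ` E} = g <#\<^bsub>G\<^esub> {h \<in> A. \<theta> h x \<in> E}"
    proof (intro equalityI subsetI)
      fix k assume "k \<in> {h \<in> A. \<theta> h x \<in> \<theta> g ` E}"
      then obtain y where k: "k \<in> A" "\<theta> k x = \<theta> g y" "y \<in> E" by auto
      have kG: "k \<in> carrier G" using k by (simp add: A_def)
      have "\<theta> k x \<in> D (inv\<^bsub>G\<^esub> (inv\<^bsub>G\<^esub> g))"
        using k E g action_image[OF g] by auto
      from step[OF _ k(1) this] g
      have "inv\<^bsub>G\<^esub> g \<otimes>\<^bsub>G\<^esub> k \<in> A" "\<theta> (inv\<^bsub>G\<^esub> g \<otimes>\<^bsub>G\<^esub> k) x = \<theta> (inv\<^bsub>G\<^esub> g) (\<theta> k x)" by auto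
      moreover have "\<theta> (inv\<^bsub>G\<^esub> g) (\<theta> k x) = y" using k E g action_inverse by auto
      moreover have "k = g \<otimes>\<^bsub>G\<^esub> (inv\<^bsub>G\<^esub> g \<otimes>\<^bsub>G\<^esub> k)" using g kG by (simp add: m_assoc[symmetric])
      ultimately show "k \<in> g <#\<^bsub>G\<^esub> {h \<in> A. \<theta> h x \<in> E}"
        using k(3) unfolding l_coset_def by auto
    next
      fix k assume "k \<in> g <#\<^bsub>G\<^esub> {h \<in> A. \<theta> h x \<in> E}"
      then show "k \<in> {h \<in> A. \<theta> h x \<in> \<theta> g ` E}"
        using step[OF g] E unfolding l_coset_def by auto
    qed
    then show "m (\<theta> g ` E) = m E"
      unfolding m_def using \<mu>(3)[OF g, of "{h \<in> A. \<theta> h x \<in> E}"] by (auto simp: A_def)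
  qed (use assms in auto)
  have "{h \<in> A. \<theta> h x \<in> topspace X} = A"
    using orbit domain_subset by (auto simp: A_def)
  then have "emeasure content_measure (topspace X) = 1"
    using \<mu>(4) by (simp add: emeasure_content_measure_space m_def)
  moreover have "space content_measure = topspace X"
    using sets_eq_imp_space_eq[OF sets_content_measure] by (simp add: space_borel_of_topology)
  ultimately have "prob_space content_measure" by (intro prob_spaceI) simp
  then show "\<exists>\<nu>. sets \<nu> = sets (borel_of_topology X) \<and> prob_space \<nu> \<and> invariant_measure G D \<theta> \<nu>"
    using sets_content_measure invariant_content_measure by blast
qed

subsection \<open>Extending a partially invariant content to the group\<close>

text \<open>Allows the colourings of two disjoint sets to be chosen independently in the proof of
  additivity below.\<close>

lemma ennreal_SUP_add_SUP_le:
  fixes f :: "'a \<Rightarrow> ennreal" and g :: "'b \<Rightarrow> ennreal"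
  assumes "I \<noteq> {}" "J \<noteq> {}" "\<And>i j. i \<in> I \<Longrightarrow> j \<in> J \<Longrightarrow> f i + g j \<le> d"
  shows "(SUP i\<in>I. f i) + (SUP j\<in>J. g j) \<le> d"
  unfolding ennreal_SUP_add_left[OF assms(1), symmetric] ennreal_SUP_add_right[OF assms(2)]
  by (intro SUP_least assms)

locale partially_invariant_content = group G
  for G :: "('g, 'm) monoid_scheme" (structure) +
  fixes A :: "'g set" and m :: "'g set \<Rightarrow> ennreal"
  assumes subset: "A \<subseteq> carrier G"
    and positive: "positive (Pow A) m"
    and additive: "Measure_Space.additive (Pow A) m"
    and translate: "g \<in> carrier G \<Longrightarrow> E \<subseteq> A \<Longrightarrow> g <# E \<subseteq> A \<Longrightarrow> m (g <# E) = m E"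
begin

text \<open>A colouring \<open>c\<close> cuts \<open>E\<close> into pieces, the piece of colour \<open>g\<close> being moved by \<open>g\<close>; only the
  points that land in \<open>A\<close> count.\<close>

definition piece :: "('g \<Rightarrow> 'g) \<Rightarrow> 'g set \<Rightarrow> 'g \<Rightarrow> 'g set" where
  "piece c E g = {x \<in> E. c x = g \<and> g \<otimes> x \<in> A}"

definition pieces_sum :: "'g set \<Rightarrow> ('g \<Rightarrow> 'g) \<Rightarrow> 'g set \<Rightarrow> ennreal" where
  "pieces_sum F c E = (\<Sum>g\<in>F. m (g <# piece c E g))"

text \<open>In a pair \<open>(F, c)\<close> only the finitely many colours in \<open>F\<close> are
  counted. Encoding the cutting as a function \<open>c\<close> makes pieces of different colours
  disjoint automatically.\<close>

definition colourings :: "('g set \<times> ('g \<Rightarrow> 'g)) set" where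
  "colourings = {F. finite F \<and> F \<subseteq> carrier G} \<times> (carrier G \<rightarrow> carrier G)"

definition extension :: "'g set \<Rightarrow> ennreal" where
  "extension E = (SUP (F, c)\<in>colourings. pieces_sum F c E)"

lemma translate_piece_subset: "g <# piece c E g \<subseteq> A"
  by (auto simp: piece_def l_coset_def)

lemma pieces_sum_le_extension:
  "finite F \<Longrightarrow> F \<subseteq> carrier G \<Longrightarrow> c \<in> carrier G \<rightarrow> carrier G \<Longrightarrow> pieces_sum F c E \<le> extension E"
  unfolding extension_def by (rule SUP_upper2[of "(F, c)"]) (auto simp: colourings_def)

lemma extension_leI:
  assumes "\<And>F c. finite F \<Longrightarrow> F \<subseteq> carrier G \<Longrightarrow> c \<in> carrier G \<rightarrow> carrier G \<Longrightarrow> pieces_sum F c E \<le> d"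
  shows "extension E \<le> d"
  unfolding extension_def by (rule SUP_least) (auto simp: colourings_def intro: assms)

lemma colourings_nonempty: "colourings \<noteq> {}"
  unfolding colourings_def by auto

text \<open>Left translation is injective, so for each colour the pieces of two disjoint sets stay
  disjoint after being moved into \<open>A\<close>.\<close>

lemma pieces_sum_union:
  assumes "F \<subseteq> carrier G" "E \<subseteq> carrier G" "E' \<subseteq> carrier G" "E \<inter> E' = {}"
  shows "pieces_sum F c (E \<union> E') = pieces_sum F c E + pieces_sum F c E'"
  unfolding pieces_sum_def sum.distrib[symmetric]
proof (rule sum.cong)
  fix g assume g: "g \<in> F"
  have "g <# piece c (E \<union> E') g = (g <# piece c E g) \<union> (g <# piece c E' g)"
    by (auto simp: piece_def l_coset_def)
  moreover have "(g <# piece c E g) \<inter> (g <# piece c E' g) = {}"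
  proof -
    have "x = y" if "x \<in> E" "y \<in> E'" "g \<otimes> x = g \<otimes> y" for x y
      using that assms g by (metis Units_eq Units_l_cancel subsetD)
    then show ?thesis using assms(4) by (fastforce simp: piece_def l_coset_def)
  qed
  ultimately show "m (g <# piece c (E \<union> E') g) = m (g <# piece c E g) + m (g <# piece c E' g)"
    using additiveD[OF additive, of "g <# piece c E g" "g <# piece c E' g"] translate_piece_subset
    by auto
qed simp

lemma pieces_sum_mono_colours:
  "finite F' \<Longrightarrow> F \<subseteq> F' \<Longrightarrow> pieces_sum F c E \<le> pieces_sum F' c E"
  unfolding pieces_sum_def by (rule sum_mono2) auto

lemma pieces_sum_cong: "(\<And>x. x \<in> E \<Longrightarrow> c x = c' x) \<Longrightarrow> pieces_sum F c E = pieces_sum F c' E"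
  unfolding pieces_sum_def piece_def by (rule sum.cong) (auto intro!: arg_cong[of _ _ m] arg_cong[of _ _ "l_coset G _"])

text \<open>In one direction a single colouring of the union serves both parts. In the other,
  colourings of the disjoint sets are glued, after both have been granted the colours
  \<open>F \<union> F'\<close>, which can only increase the sums.\<close>

lemma extension_additive: "Measure_Space.additive (Pow (carrier G)) extension"
  unfolding additive_def
proof (intro ballI impI antisym)
  fix E E' assume E: "E \<in> Pow (carrier G)" "E' \<in> Pow (carrier G)" "E \<inter> E' = {}"
  show "extension (E \<union> E') \<le> extension E + extension E'"
    using E by (intro extension_leI) (auto simp: pieces_sum_union intro!: add_mono pieces_sum_le_extension)
  have "pieces_sum F c E + pieces_sum F' c' E' \<le> extension (E \<union> E')"
    if "finite F" "F \<subseteq> carrier G" "c \<in> carrier G \<rightarrow> carrier G"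
      "finite F'" "F' \<subseteq> carrier G" "c' \<in> carrier G \<rightarrow> carrier G" for F c F' c'
  proof -
    let ?c = "\<lambda>x. if x \<in> E then c x else c' x"
    have "pieces_sum F c E + pieces_sum F' c' E' \<le> pieces_sum (F \<union> F') c E + pieces_sum (F \<union> F') c' E'"
      using that by (intro add_mono pieces_sum_mono_colours) auto
    also have "\<dots> = pieces_sum (F \<union> F') ?c E + pieces_sum (F \<union> F') ?c E'"
      using E by (intro arg_cong2[of _ _ _ _ "(+)"] pieces_sum_cong) auto
    also have "\<dots> = pieces_sum (F \<union> F') ?c (E \<union> E')"
      using E that by (intro pieces_sum_union[symmetric]) auto
    also have "\<dots> \<le> extension (E \<union> E')"
      using that by (intro pieces_sum_le_extension) auto
    finally show ?thesis .
  qed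
  then show "extension E + extension E' \<le> extension (E \<union> E')"
    unfolding extension_def[of E] extension_def[of E']
    by (intro ennreal_SUP_add_SUP_le colourings_nonempty) (auto simp: colourings_def)
qed

lemma extension_empty: "extension {} = 0"
proof -
  have "pieces_sum F c {} = 0" for F c
    using positive by (simp add: pieces_sum_def piece_def l_coset_def positive_def)
  then have "extension {} \<le> 0" by (intro extension_leI) simp
  then show ?thesis by simp
qed

text \<open>Moving \<open>h \<otimes> x\<close> by \<open>g\<close> is moving \<open>x\<close> by
  \<open>g \<otimes> h\<close>. A colouring of \<open>h <# E\<close> is therefore pulled back along
  \<open>h\<close> and its colours are multiplied by \<open>h\<close> on the right.\<close>

lemma extension_translate_le:
  assumes h: "h \<in> carrier G" and E: "E \<subseteq> carrier G"
  shows "extension (h <# E) \<le> extension E"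
proof (rule extension_leI)
  fix F c assume F: "finite F" "F \<subseteq> carrier G" and c: "c \<in> carrier G \<rightarrow> carrier G"
  let ?c = "\<lambda>x. c (h \<otimes> x) \<otimes> h"
  have "pieces_sum F c (h <# E) = (\<Sum>g\<in>F. m ((g \<otimes> h) <# piece ?c E (g \<otimes> h)))"
    unfolding pieces_sum_def
  proof (intro sum.cong refl arg_cong[of _ _ m])
    fix g assume "g \<in> F"
    then have g: "g \<in> carrier G" using F by auto
    have "piece c (h <# E) g = h <# piece ?c E (g \<otimes> h)"
      using g h E c by (auto simp: piece_def l_coset_def m_assoc subset_iff Pi_iff)
    then show "g <# piece c (h <# E) g = (g \<otimes> h) <# piece ?c E (g \<otimes> h)"
      using lcos_m_assoc[OF _ g h, of "piece ?c E (g \<otimes> h)"] E by (auto simp: piece_def)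
  qed
  \<comment> \<open>Right multiplication by \<open>h\<close> is injective, so distinct colours stay
    distinct and the sum can be reindexed.\<close>
  also have "\<dots> = pieces_sum ((\<lambda>g. g \<otimes> h) ` F) ?c E"
    unfolding pieces_sum_def using F h
    by (subst sum.reindex) (auto simp: inj_on_def subset_iff)
  also have "\<dots> \<le> extension E"
    using F h c by (intro pieces_sum_le_extension) auto
  finally show "pieces_sum F c (h <# E) \<le> extension E" .
qed

lemma extension_translate:
  assumes h: "h \<in> carrier G" and E: "E \<subseteq> carrier G"
  shows "extension (h <# E) = extension E"
proof (rule antisym[OF extension_translate_le[OF h E]])
  have "inv h <# (h <# E) = E" using h E by (simp add: lcos_m_assoc lcos_mult_one)
  then show "extension E \<le> extension (h <# E)"
    using extension_translate_le[of "inv h" "h <# E"] h E l_coset_subset_G by auto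
qed

text \<open>A piece of \<open>A\<close> and its translate both lie in \<open>A\<close>, so they have
  equal content by partial invariance, and the disjoint pieces weigh at most \<open>m A\<close>. The
  single colour \<open>\<one>\<close> attains this value.\<close>

lemma extension_self: "extension A = m A"
proof (rule antisym)
  interpret S: sigma_algebra A "Pow A" by (rule sigma_algebra_Pow)
  show "extension A \<le> m A"
  proof (rule extension_leI)
    fix F c assume F: "finite F" "F \<subseteq> carrier G"
    have "pieces_sum F c A = (\<Sum>g\<in>F. m (piece c A g))"
      unfolding pieces_sum_def using F translate_piece_subset
      by (intro sum.cong refl translate) (auto simp: piece_def)
    also have "\<dots> = m (\<Union>g\<in>F. piece c A g)"
      by (rule S.additive_sum[OF positive additive F(1)]) (auto simp: piece_def disjoint_family_on_def)
    also have "\<dots> \<le> m A"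
      by (rule increasingD[OF S.additive_increasing[OF positive additive]]) (auto simp: piece_def)
    finally show "pieces_sum F c A \<le> m A" .
  qed
  have "piece (\<lambda>x. \<one>) A \<one> = A" using subset by (auto simp: piece_def)
  then have "pieces_sum {\<one>} (\<lambda>x. \<one>) A = m A"
    using subset by (simp add: pieces_sum_def lcos_mult_one)
  then show "m A \<le> extension A"
    using pieces_sum_le_extension[of "{\<one>}" "\<lambda>x. \<one>" A] by auto
qed

end

subsection \<open>The space of ultrafilters\<close>

text \<open>Ultrafilters are plain sets of subsets, so that for a group over \<open>'g\<close> the
  points have the type \<open>'g set set\<close> occurring in the theorem.\<close>

definition ultrafilters_on :: "'a set \<Rightarrow> 'a set set set" where
  "ultrafilters_on A = {p. p \<subseteq> Pow A \<and> A \<in> p \<and> {} \<notin> p \<and> (\<forall>E\<in>p. \<forall>F\<in>p. E \<inter> F \<in> p) \<and>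
     (\<forall>E\<in>p. \<forall>F. E \<subseteq> F \<and> F \<subseteq> A \<longrightarrow> F \<in> p) \<and> (\<forall>E. E \<subseteq> A \<longrightarrow> E \<in> p \<or> A - E \<in> p)}"

definition ultra_basic :: "'a set \<Rightarrow> 'a set \<Rightarrow> 'a set set set" where
  "ultra_basic A E = {p \<in> ultrafilters_on A. E \<in> p}"

definition stone_topology :: "'a set \<Rightarrow> 'a set set topology" where
  "stone_topology A = topology (\<lambda>U. U \<subseteq> ultrafilters_on A \<and> (\<forall>p\<in>U. \<exists>E\<in>p. ultra_basic A E \<subseteq> U))"

lemma ultrafilters_onI:
  assumes "\<And>E. E \<in> p \<Longrightarrow> E \<subseteq> A" "A \<in> p" "{} \<notin> p"
    and "\<And>E F. E \<in> p \<Longrightarrow> F \<in> p \<Longrightarrow> E \<inter> F \<in> p"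
    and "\<And>E F. E \<in> p \<Longrightarrow> E \<subseteq> F \<Longrightarrow> F \<subseteq> A \<Longrightarrow> F \<in> p"
    and "\<And>E. E \<subseteq> A \<Longrightarrow> E \<notin> p \<Longrightarrow> A - E \<in> p"
  shows "p \<in> ultrafilters_on A"
proof -
  have "p \<subseteq> Pow A" using assms(1) by auto
  moreover have "E \<in> p \<or> A - E \<in> p" if "E \<subseteq> A" for E using assms(6) that by auto
  ultimately show ?thesis using assms(2-5) by (simp add: ultrafilters_on_def)
qed

context
  fixes A :: "'a set" and p assumes p: "p \<in> ultrafilters_on A"
begin

lemma ultrafilter_subset: "E \<in> p \<Longrightarrow> E \<subseteq> A"
  and ultrafilter_whole: "A \<in> p"
  and ultrafilter_empty: "{} \<notin> p"
  and ultrafilter_Int: "E \<in> p \<Longrightarrow> F \<in> p \<Longrightarrow> E \<inter> F \<in> p"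
  and ultrafilter_mono: "E \<in> p \<Longrightarrow> E \<subseteq> F \<Longrightarrow> F \<subseteq> A \<Longrightarrow> F \<in> p"
  and ultrafilter_cases: "E \<subseteq> A \<Longrightarrow> E \<in> p \<or> A - E \<in> p"
  using p unfolding ultrafilters_on_def by auto

lemma ultrafilter_Compl: "E \<subseteq> A \<Longrightarrow> A - E \<in> p \<longleftrightarrow> E \<notin> p"
  using ultrafilter_cases[of E] ultrafilter_Int[of E "A - E"] ultrafilter_empty
  by auto

lemma ultrafilter_conj:
  "{x \<in> A. P x \<and> Q x} \<in> p \<longleftrightarrow> {x \<in> A. P x} \<in> p \<and> {x \<in> A. Q x} \<in> p"
proof -
  have "{x \<in> A. P x \<and> Q x} = {x \<in> A. P x} \<inter> {x \<in> A. Q x}" by auto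
  then show ?thesis
    using ultrafilter_Int[of "{x \<in> A. P x}" "{x \<in> A. Q x}"]
      ultrafilter_mono[of "{x \<in> A. P x \<and> Q x}" "{x \<in> A. P x}"]
      ultrafilter_mono[of "{x \<in> A. P x \<and> Q x}" "{x \<in> A. Q x}"] by auto
qed

text \<open>Thanks to this primeness \<open>ultra_basic A\<close> respects unions, on which
  additivity of the content on \<open>A\<close> will rest.\<close>

lemma ultrafilter_disj:
  assumes "E \<subseteq> A" "F \<subseteq> A" shows "E \<union> F \<in> p \<longleftrightarrow> E \<in> p \<or> F \<in> p"
proof
  assume "E \<union> F \<in> p"
  show "E \<in> p \<or> F \<in> p"
  proof (rule ccontr)
    assume "\<not> (E \<in> p \<or> F \<in> p)"
    then have "(A - E) \<inter> (A - F) \<inter> (E \<union> F) \<in> p"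
      using ultrafilter_Compl[OF assms(1)] ultrafilter_Compl[OF assms(2)] \<open>E \<union> F \<in> p\<close>
      by (auto intro!: ultrafilter_Int simp del: Diff_disjoint)
    moreover have "(A - E) \<inter> (A - F) \<inter> (E \<union> F) = {}" by auto
    ultimately show False using ultrafilter_empty by simp
  qed
next
  assume "E \<in> p \<or> F \<in> p"
  then show "E \<union> F \<in> p"
    using assms ultrafilter_mono[of E "E \<union> F"] ultrafilter_mono[of F "E \<union> F"] by auto
qed

lemma ultrafilter_Inter: "finite \<F> \<Longrightarrow> \<F> \<subseteq> p \<Longrightarrow> A \<inter> \<Inter>\<F> \<in> p"
proof (induction rule: finite_induct)
  case empty
  then show ?case using ultrafilter_whole by simp
next
  case (insert E \<F>)
  then have "E \<inter> (A \<inter> \<Inter>\<F>) \<in> p" using ultrafilter_Int[of E "A \<inter> \<Inter>\<F>"] by simp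
  moreover have "E \<inter> (A \<inter> \<Inter>\<F>) = A \<inter> \<Inter>(insert E \<F>)" by auto
  ultimately show ?case by (simp only:)
qed

end

text \<open>Zorn's lemma gives a maximal family above \<open>S\<close> with the finite intersection
  property, and maximality makes it an ultrafilter. Intersecting with \<open>A\<close> makes the
  empty intersection \<open>A\<close> rather than the whole type.\<close>

lemma ultrafilter_extends:
  assumes S: "S \<subseteq> Pow A" and fip: "\<And>\<F>. finite \<F> \<Longrightarrow> \<F> \<subseteq> S \<Longrightarrow> A \<inter> \<Inter>\<F> \<noteq> {}"
  shows "\<exists>p\<in>ultrafilters_on A. S \<subseteq> p"
proof -
  define \<A> where "\<A> = {P. S \<subseteq> P \<and> P \<subseteq> Pow A \<and> (\<forall>\<F>. finite \<F> \<and> \<F> \<subseteq> P \<longrightarrow> A \<inter> \<Inter>\<F> \<noteq> {})}"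
  have "\<exists>M\<in>\<A>. \<forall>X\<in>\<A>. M \<subseteq> X \<longrightarrow> X = M"
  proof (rule subset_Zorn_nonempty)
    show "\<A> \<noteq> {}" using S fip unfolding \<A>_def by blast
    fix \<C> assume C: "\<C> \<noteq> {}" "subset.chain \<A> \<C>"
    have sub: "\<C> \<subseteq> \<A>" using C(2) by (auto simp: subset.chain_def)
    have "A \<inter> \<Inter>\<F> \<noteq> {}" if F: "finite \<F>" "\<F> \<subseteq> \<Union>\<C>" for \<F>
    proof -
      obtain P where "P \<in> \<C>" "\<F> \<subseteq> P"
        using finite_subset_Union_chain[OF F C] by blast
      then show ?thesis using sub F(1) unfolding \<A>_def by blast
    qed
    moreover have "S \<subseteq> P \<and> P \<subseteq> Pow A" if "P \<in> \<C>" for P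
      using sub that unfolding \<A>_def by auto
    then have "S \<subseteq> \<Union>\<C>" "\<Union>\<C> \<subseteq> Pow A" using C(1) by fast+
    ultimately show "\<Union>\<C> \<in> \<A>" unfolding \<A>_def by simp
  qed
  then obtain M where M: "M \<in> \<A>" and max: "\<And>X. X \<in> \<A> \<Longrightarrow> M \<subseteq> X \<Longrightarrow> X = M" by blast
  have fipM: "A \<inter> \<Inter>\<F> \<noteq> {}" if "finite \<F>" "\<F> \<subseteq> M" for \<F>
    using M that unfolding \<A>_def by blast
  have MA: "S \<subseteq> M" "M \<subseteq> Pow A" using M unfolding \<A>_def by auto
  \<comment> \<open>Maximality in usable form: a set meeting all finite intersections from
    \<open>M\<close> can be added without losing the property, so it is already in
    \<open>M\<close>.\<close>
  have mem: "E \<in> M" if E: "E \<subseteq> A" and meets: "\<And>\<F>. finite \<F> \<Longrightarrow> \<F> \<subseteq> M \<Longrightarrow> A \<inter> \<Inter>\<F> \<inter> E \<noteq> {}" for E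
  proof -
    have "A \<inter> \<Inter>\<F> \<noteq> {}" if "finite \<F>" "\<F> \<subseteq> insert E M" for \<F>
      using meets[of "\<F> - {E}"] that by auto
    then have "insert E M \<in> \<A>" using MA E unfolding \<A>_def by auto
    from max[OF this] show ?thesis by auto
  qed
  have memInter: "E \<in> M" if "E \<subseteq> A" "finite \<F>" "\<F> \<subseteq> M" "A \<inter> \<Inter>\<F> \<subseteq> E" for E \<F>
  proof (rule mem[OF that(1)])
    fix \<F>' assume "finite \<F>'" "\<F>' \<subseteq> M"
    then have "A \<inter> \<Inter>(\<F> \<union> \<F>') \<noteq> {}" using that by (intro fipM) auto
    then show "A \<inter> \<Inter>\<F>' \<inter> E \<noteq> {}" using that(4) by auto
  qed
  have "M \<in> ultrafilters_on A"
  proof (rule ultrafilters_onI)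
    show "E \<subseteq> A" if "E \<in> M" for E using that MA(2) by auto
    show "A \<in> M" by (rule memInter[of _ "{}"]) auto
    show "{} \<notin> M" using fipM[of "{{}}"] by auto
    show "E \<inter> F \<in> M" if "E \<in> M" "F \<in> M" for E F
      using that MA by (intro memInter[of _ "{E, F}"]) auto
    show "F \<in> M" if "E \<in> M" "E \<subseteq> F" "F \<subseteq> A" for E F
      using that by (intro memInter[of _ "{E}"]) auto
    show "A - E \<in> M" if E: "E \<subseteq> A" "E \<notin> M" for E
    proof (rule ccontr)
      assume *: "A - E \<notin> M"
      \<comment> \<open>If \<open>E\<close> and \<open>A - E\<close> are both missing, each is
        disjoint from some finite intersection, and the joint intersection would have to be
        empty.\<close>
      obtain \<F> where 1: "finite \<F>" "\<F> \<subseteq> M" "A \<inter> \<Inter>\<F> \<inter> E = {}" using mem[of E] E by blast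
      from * obtain \<F>' where 2: "finite \<F>'" "\<F>' \<subseteq> M" "A \<inter> \<Inter>\<F>' \<inter> (A - E) = {}"
        using mem[of "A - E"] by blast
      have "A \<inter> \<Inter>(\<F> \<union> \<F>') \<noteq> {}" using 1 2 by (intro fipM) auto
      then obtain x where "x \<in> A" "x \<in> \<Inter>\<F>" "x \<in> \<Inter>\<F>'" by auto
      with 1(3) 2(3) show False by blast
    qed
  qed
  with MA(1) show ?thesis by (intro bexI)
qed

lemma ultrafilters_on_nonempty: "A \<noteq> {} \<Longrightarrow> ultrafilters_on A \<noteq> {}"
  using ultrafilter_extends[of "{}" A] by auto

section \<open>The Stone topology is compact Hausdorff\<close>

lemma openin_stone_topology:
  "openin (stone_topology A) U \<longleftrightarrow>
    U \<subseteq> ultrafilters_on A \<and> (\<forall>p\<in>U. \<exists>E\<in>p. ultra_basic A E \<subseteq> U)"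
proof -
  let ?L = "\<lambda>U. U \<subseteq> ultrafilters_on A \<and> (\<forall>p\<in>U. \<exists>E\<in>p. ultra_basic A E \<subseteq> U)"
  have "istopology ?L"
    unfolding istopology_def
  proof (intro conjI allI impI)
    fix U V assume UV: "?L U" "?L V"
    from UV(1) show "U \<inter> V \<subseteq> ultrafilters_on A" by (simp add: le_infI1)
    show "\<forall>p\<in>U \<inter> V. \<exists>E\<in>p. ultra_basic A E \<subseteq> U \<inter> V"
    proof
      fix p assume p: "p \<in> U \<inter> V"
      obtain E where E: "E \<in> p" "ultra_basic A E \<subseteq> U" using UV(1) p by auto
      obtain F where F: "F \<in> p" "ultra_basic A F \<subseteq> V" using UV(2) p by auto
      have pu: "p \<in> ultrafilters_on A" using p UV(1) by auto
      have "ultra_basic A (E \<inter> F) \<subseteq> ultra_basic A E \<inter> ultra_basic A F"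
        using ultrafilter_mono[of _ A "E \<inter> F" E] ultrafilter_mono[of _ A "E \<inter> F" F]
          ultrafilter_subset[OF pu E(1)] ultrafilter_subset[OF pu F(1)]
        by (auto simp: ultra_basic_def)
      then have "ultra_basic A (E \<inter> F) \<subseteq> U \<inter> V" using E(2) F(2) by auto
      moreover have "E \<inter> F \<in> p" by (rule ultrafilter_Int[OF pu E(1) F(1)])
      ultimately show "\<exists>E\<in>p. ultra_basic A E \<subseteq> U \<inter> V" by (rule bexI)
    qed
  next
    fix \<K> assume K: "\<forall>K\<in>\<K>. ?L K"
    then show "\<Union>\<K> \<subseteq> ultrafilters_on A" by (simp add: Union_least)
    show "\<forall>p\<in>\<Union>\<K>. \<exists>E\<in>p. ultra_basic A E \<subseteq> \<Union>\<K>"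
    proof
      fix p assume "p \<in> \<Union>\<K>"
      then obtain U where U: "U \<in> \<K>" "p \<in> U" by auto
      from bspec[OF K U(1)] U(2) obtain E where "E \<in> p" "ultra_basic A E \<subseteq> U" by blast
      then show "\<exists>E\<in>p. ultra_basic A E \<subseteq> \<Union>\<K>" using U(1) by auto
    qed
  qed
  then show ?thesis unfolding stone_topology_def by (simp add: topology_inverse')
qed

lemma openin_ultra_basic: "openin (stone_topology A) (ultra_basic A E)"
  unfolding openin_stone_topology by (auto simp: ultra_basic_def)

lemma topspace_stone_topology: "topspace (stone_topology A) = ultrafilters_on A"
proof
  have "openin (stone_topology A) (ultrafilters_on A)"
    unfolding openin_stone_topology using ultrafilter_whole by (fastforce simp: ultra_basic_def)
  then show "ultrafilters_on A \<subseteq> topspace (stone_topology A)" by (rule openin_subset)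
  show "topspace (stone_topology A) \<subseteq> ultrafilters_on A"
    using openin_topspace[of "stone_topology A"] unfolding openin_stone_topology by simp
qed

lemma Hausdorff_stone_topology: "Hausdorff_space (stone_topology A)"
  unfolding Hausdorff_space_def topspace_stone_topology
proof (intro allI impI)
  fix p q assume pq: "p \<in> ultrafilters_on A \<and> q \<in> ultrafilters_on A \<and> p \<noteq> q"
  then obtain E where E: "E \<in> p \<longleftrightarrow> E \<notin> q" by blast
  with pq have "E \<subseteq> A" using ultrafilter_subset[of p A E] ultrafilter_subset[of q A E] by auto
  note E = this E
  have disj: "disjnt (ultra_basic A E) (ultra_basic A (A - E))"
    using ultrafilter_Compl[OF _ E(1)] by (auto simp: disjnt_def ultra_basic_def)
  show "\<exists>U V. openin (stone_topology A) U \<and> openin (stone_topology A) V \<and> p \<in> U \<and> q \<in> V \<and> disjnt U V"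
  proof (cases "E \<in> p")
    case True
    then have "p \<in> ultra_basic A E" "q \<in> ultra_basic A (A - E)"
      using E pq ultrafilter_Compl[of _ A E] by (auto simp: ultra_basic_def)
    then show ?thesis using disj openin_ultra_basic by (intro exI conjI)
  next
    case False
    then have "q \<in> ultra_basic A E" "p \<in> ultra_basic A (A - E)"
      using E pq ultrafilter_Compl[of _ A E] by (auto simp: ultra_basic_def)
    then show ?thesis using disjnt_sym[OF disj] openin_ultra_basic by (intro exI conjI)
  qed
qed

text \<open>\<open>S\<close> collects the complements of index sets whose basic sets fit into a
  member of the cover. An ultrafilter containing \<open>S\<close> would escape the cover, so some
  finite part of \<open>S\<close> has empty intersection in \<open>A\<close>, and the corresponding
  cover members form a finite subcover.\<close>

lemma compact_stone_topology: "compact_space (stone_topology A)"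
  unfolding compact_space_alt topspace_stone_topology
proof (intro allI impI)
  fix \<U> assume U: "(\<forall>U\<in>\<U>. openin (stone_topology A) U) \<and> ultrafilters_on A \<subseteq> \<Union>\<U>"
  define S where "S = {C. C \<subseteq> A \<and> (\<exists>U\<in>\<U>. ultra_basic A (A - C) \<subseteq> U)}"
  have SA: "S \<subseteq> Pow A" unfolding S_def by auto
  have "\<exists>\<F>. finite \<F> \<and> \<F> \<subseteq> S \<and> A \<inter> \<Inter>\<F> = {}"
  proof (rule ccontr)
    assume "\<nexists>\<F>. finite \<F> \<and> \<F> \<subseteq> S \<and> A \<inter> \<Inter>\<F> = {}"
    then obtain p where p: "p \<in> ultrafilters_on A" "S \<subseteq> p"
      using ultrafilter_extends[OF SA] by auto
    obtain V where V: "V \<in> \<U>" "p \<in> V" using U p(1) by auto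
    then have "openin (stone_topology A) V" using U by simp
    then have "\<exists>E\<in>p. ultra_basic A E \<subseteq> V" using V(2) by (simp add: openin_stone_topology)
    then obtain E where VE: "E \<in> p" "ultra_basic A E \<subseteq> V" by auto
    have E: "E \<subseteq> A" by (rule ultrafilter_subset[OF p(1) VE(1)])
    then have "A - (A - E) = E" by auto
    then have "A - E \<in> S" using V(1) VE(2) by (auto simp: S_def)
    then show False using ultrafilter_Compl[OF p(1) E] p(2) VE(1) by auto
  qed
  then obtain \<F> where F: "finite \<F>" "\<F> \<subseteq> S" "A \<inter> \<Inter>\<F> = {}" by auto
  have "\<forall>C\<in>\<F>. \<exists>U. U \<in> \<U> \<and> ultra_basic A (A - C) \<subseteq> U"
    using F(2) by (auto simp: S_def)
  from bchoice[OF this]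
  obtain u where u: "\<And>C. C \<in> \<F> \<Longrightarrow> u C \<in> \<U> \<and> ultra_basic A (A - C) \<subseteq> u C" by blast
  have "ultrafilters_on A \<subseteq> \<Union>(u ` \<F>)"
  proof
    fix p assume p: "p \<in> ultrafilters_on A"
    then have "\<not> \<F> \<subseteq> p" using ultrafilter_Inter[OF p F(1)] ultrafilter_empty[OF p] F(3) by auto
    then obtain C where C: "C \<in> \<F>" "C \<notin> p" by auto
    then have "p \<in> ultra_basic A (A - C)"
      using ultrafilter_cases[OF p, of C] p F(2) SA by (auto simp: ultra_basic_def)
    then show "p \<in> \<Union>(u ` \<F>)" using u[OF C(1)] C(1) by auto
  qed
  then show "\<exists>\<F>. finite \<F> \<and> \<F> \<subseteq> \<U> \<and> ultrafilters_on A \<subseteq> \<Union>\<F>"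
    using F(1) u by (intro exI[of _ "u ` \<F>"]) auto
qed

subsection \<open>Partial translation of ultrafilters\<close>

locale group_subset = group G for G :: "('g, 'm) monoid_scheme" (structure) +
  fixes A :: "'g set" assumes subset: "A \<subseteq> carrier G"
begin

text \<open>For \<open>g\<close> in the group these are the ultrafilters containing the intersection
  of \<open>A\<close> with \<open>g <# A\<close>, the range of the partial translation by
  \<open>g\<close> on \<open>A\<close>.\<close>

definition ultra_dom :: "'g \<Rightarrow> 'g set set set" where
  "ultra_dom g = ultra_basic A {x \<in> A. inv g \<otimes> x \<in> A}"

text \<open>The push-forward of \<open>p\<close> along the partial translation by
  \<open>g\<close>.\<close>

definition ultra_act :: "'g \<Rightarrow> 'g set set \<Rightarrow> 'g set set" where
  "ultra_act g p = {E. E \<subseteq> A \<and> {x \<in> A. g \<otimes> x \<in> E} \<in> p}"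

lemma ultra_dom_inv:
  "g \<in> carrier G \<Longrightarrow> p \<in> ultra_dom (inv g) \<longleftrightarrow> p \<in> ultrafilters_on A \<and> {x \<in> A. g \<otimes> x \<in> A} \<in> p"
  by (simp add: ultra_dom_def ultra_basic_def)

lemma inv_mult_cancel:
  assumes "g \<in> carrier G" "x \<in> A" shows "inv g \<otimes> (g \<otimes> x) = x"
proof -
  have "x \<in> carrier G" using assms subset by auto
  then have "inv g \<otimes> (g \<otimes> x) = inv g \<otimes> g \<otimes> x"
    using assms by (intro m_assoc[symmetric]) simp_all
  with \<open>x \<in> carrier G\<close> show ?thesis using assms by simp
qed

lemma ultra_act_ultrafilter:
  assumes g: "g \<in> carrier G" and p: "p \<in> ultra_dom (inv g)"
  shows "ultra_act g p \<in> ultrafilters_on A"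
proof -
  have pu: "p \<in> ultrafilters_on A" and pA: "{x \<in> A. g \<otimes> x \<in> A} \<in> p"
    using p by (simp_all add: ultra_dom_inv g)
  have mem: "E \<in> ultra_act g p \<longleftrightarrow> E \<subseteq> A \<and> {x \<in> A. g \<otimes> x \<in> E} \<in> p" for E
    by (simp add: ultra_act_def)
  show ?thesis
  proof (rule ultrafilters_onI)
    show "E \<subseteq> A" if "E \<in> ultra_act g p" for E using that by (simp add: mem)
    show "A \<in> ultra_act g p" using pA by (simp add: mem)
    show "{} \<notin> ultra_act g p" using ultrafilter_empty[OF pu] by (simp add: mem)
    show "E \<inter> F \<in> ultra_act g p" if "E \<in> ultra_act g p" "F \<in> ultra_act g p" for E F
      using that by (simp add: mem ultrafilter_conj[OF pu] le_infI1)
    show "F \<in> ultra_act g p" if EF: "E \<in> ultra_act g p" "E \<subseteq> F" "F \<subseteq> A" for E F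
      unfolding mem
    proof
      show "{x \<in> A. g \<otimes> x \<in> F} \<in> p"
        by (rule ultrafilter_mono[OF pu, of "{x \<in> A. g \<otimes> x \<in> E}"]) (use EF mem in auto)
    qed (rule EF)
    show "A - E \<in> ultra_act g p" if E: "E \<subseteq> A" "E \<notin> ultra_act g p" for E
      unfolding mem
    proof
      have "A - {x \<in> A. g \<otimes> x \<in> E} \<in> p"
        using E mem ultrafilter_Compl[OF pu, of "{x \<in> A. g \<otimes> x \<in> E}"] by simp
      \<comment> \<open>The complement also contains points that \<open>g\<close> moves out of
        \<open>A\<close>; intersecting with the domain of the translation discards them.\<close>
      then have "{x \<in> A. g \<otimes> x \<in> A} \<inter> (A - {x \<in> A. g \<otimes> x \<in> E}) \<in> p"
        by (rule ultrafilter_Int[OF pu pA])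
      moreover have "{x \<in> A. g \<otimes> x \<in> A} \<inter> (A - {x \<in> A. g \<otimes> x \<in> E}) = {x \<in> A. g \<otimes> x \<in> A - E}"
        by auto
      ultimately show "{x \<in> A. g \<otimes> x \<in> A - E} \<in> p" by (simp only:)
    qed auto
  qed
qed

lemma ultra_act_dom:
  assumes g: "g \<in> carrier G" and p: "p \<in> ultra_dom (inv g)"
  shows "ultra_act g p \<in> ultra_dom g"
proof -
  have "{x \<in> A. g \<otimes> x \<in> {y \<in> A. inv g \<otimes> y \<in> A}} = {x \<in> A. g \<otimes> x \<in> A}"
    using inv_mult_cancel[OF g] by auto
  then show ?thesis
    using p ultra_act_ultrafilter[OF g p]
    by (simp add: ultra_dom_inv g ultra_dom_def[of g] ultra_basic_def ultra_act_def)
qed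

text \<open>Translating in two stages imposes the extra condition
  \<open>g \<otimes> x \<in> A\<close>, but the set of such \<open>x\<close> belongs to
  \<open>p\<close>, so membership in \<open>p\<close> is unaffected.\<close>

lemma ultra_act_comp:
  assumes g: "g \<in> carrier G" and h: "h \<in> carrier G"
    and p: "p \<in> ultra_dom (inv g)" and q: "ultra_act g p \<in> ultra_dom (inv h)"
  shows "p \<in> ultra_dom (inv (h \<otimes> g))" and "ultra_act (h \<otimes> g) p = ultra_act h (ultra_act g p)"
proof -
  have pu: "p \<in> ultrafilters_on A" and pA: "{x \<in> A. g \<otimes> x \<in> A} \<in> p"
    using p by (simp_all add: ultra_dom_inv g)
  have eq: "{x \<in> A. g \<otimes> x \<in> {y \<in> A. h \<otimes> y \<in> E}} = {x \<in> A. g \<otimes> x \<in> A \<and> h \<otimes> g \<otimes> x \<in> E}" for E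
    using g h subset by (auto simp: m_assoc subset_iff)
  have comp: "{x \<in> A. g \<otimes> x \<in> {y \<in> A. h \<otimes> y \<in> E}} \<in> p \<longleftrightarrow> {x \<in> A. h \<otimes> g \<otimes> x \<in> E} \<in> p" for E
    unfolding eq ultrafilter_conj[OF pu] using pA by simp
  have "{x \<in> A. g \<otimes> x \<in> {y \<in> A. h \<otimes> y \<in> A}} \<in> p"
    using q by (simp only: ultra_dom_inv[OF h] ultra_act_def) simp
  then show "p \<in> ultra_dom (inv (h \<otimes> g))"
    using pu g h comp by (simp only: ultra_dom_inv m_closed)
  show "ultra_act (h \<otimes> g) p = ultra_act h (ultra_act g p)"
    using comp by (auto simp only: ultra_act_def mem_Collect_eq)
qed

lemma ultra_act_one:
  assumes "p \<in> ultrafilters_on A" shows "ultra_act \<one> p = p"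
proof -
  have "{x \<in> A. \<one> \<otimes> x \<in> E} = E" if "E \<subseteq> A" for E using that subset by auto
  then show ?thesis using ultrafilter_subset[OF assms] by (auto simp: ultra_act_def)
qed

lemma ultra_act_inverse:
  assumes g: "g \<in> carrier G" and p: "p \<in> ultra_dom (inv g)"
  shows "ultra_act (inv g) (ultra_act g p) = p"
proof -
  have "ultra_act g p \<in> ultra_dom (inv (inv g))" using ultra_act_dom[OF g p] g by simp
  then have "ultra_act (inv g \<otimes> g) p = ultra_act (inv g) (ultra_act g p)"
    by (intro ultra_act_comp p g inv_closed)
  then show ?thesis using p g ultra_act_one by (simp add: ultra_dom_inv)
qed

lemma openin_ultra_dom: "openin (stone_topology A) (ultra_dom g)"
  unfolding ultra_dom_def by (rule openin_ultra_basic)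

lemma ultra_dom_subset: "ultra_dom g \<subseteq> ultrafilters_on A"
  unfolding ultra_dom_def ultra_basic_def by auto

text \<open>If \<open>E\<close> is in the image of \<open>p\<close>, then
  \<open>{x \<in> A. g \<otimes> x \<in> E}\<close> is in \<open>p\<close>, and its basic set lies
  in the domain and is mapped into the basic set of \<open>E\<close>.\<close>

lemma continuous_ultra_act:
  assumes g: "g \<in> carrier G"
  shows "continuous_map (subtopology (stone_topology A) (ultra_dom (inv g)))
    (subtopology (stone_topology A) (ultra_dom g)) (ultra_act g)"
proof -
  have top: "topspace (subtopology (stone_topology A) (ultra_dom h)) = ultra_dom h" for h
    using ultra_dom_subset[of h] by (auto simp: topspace_stone_topology)
  have "openin (stone_topology A) {p \<in> ultra_dom (inv g). ultra_act g p \<in> U}"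
    if U: "openin (stone_topology A) U" for U
    unfolding openin_stone_topology
  proof (intro conjI ballI)
    show "{p \<in> ultra_dom (inv g). ultra_act g p \<in> U} \<subseteq> ultrafilters_on A"
      using ultra_dom_subset by auto
    fix p assume "p \<in> {p \<in> ultra_dom (inv g). ultra_act g p \<in> U}"
    then have p: "p \<in> ultra_dom (inv g)" "ultra_act g p \<in> U" by auto
    have "\<exists>E\<in>ultra_act g p. ultra_basic A E \<subseteq> U"
      using U p(2) by (simp add: openin_stone_topology)
    then obtain E where E: "E \<in> ultra_act g p" "ultra_basic A E \<subseteq> U" by auto
    have EA: "E \<subseteq> A" using E(1) by (simp add: ultra_act_def)
    show "\<exists>F\<in>p. ultra_basic A F \<subseteq> {p \<in> ultra_dom (inv g). ultra_act g p \<in> U}"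
    proof (rule bexI)
      show "{x \<in> A. g \<otimes> x \<in> E} \<in> p" using E(1) by (simp add: ultra_act_def)
      show "ultra_basic A {x \<in> A. g \<otimes> x \<in> E} \<subseteq> {p \<in> ultra_dom (inv g). ultra_act g p \<in> U}"
      proof
        fix q assume "q \<in> ultra_basic A {x \<in> A. g \<otimes> x \<in> E}"
        then have q: "q \<in> ultrafilters_on A" "{x \<in> A. g \<otimes> x \<in> E} \<in> q"
          by (simp_all add: ultra_basic_def)
        have "{x \<in> A. g \<otimes> x \<in> A} \<in> q"
          using EA by (intro ultrafilter_mono[OF q]) auto
        then have qd: "q \<in> ultra_dom (inv g)" using q(1) by (simp add: ultra_dom_inv g)
        have "E \<in> ultra_act g q" using EA q(2) by (simp add: ultra_act_def)
        then have "ultra_act g q \<in> ultra_basic A E"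
          using ultra_act_ultrafilter[OF g qd] by (simp add: ultra_basic_def)
        then show "q \<in> {p \<in> ultra_dom (inv g). ultra_act g p \<in> U}" using qd E(2) by auto
      qed
    qed
  qed
  then have "continuous_map (subtopology (stone_topology A) (ultra_dom (inv g)))
      (stone_topology A) (ultra_act g)"
    unfolding continuous_map_def top topspace_stone_topology
    using ultra_act_ultrafilter[OF g] by (auto simp: openin_open_subtopology openin_ultra_dom)
  then show ?thesis
    unfolding continuous_map_in_subtopology top using ultra_act_dom[OF g] by auto
qed

lemma partial_action_stone: "partial_action G (stone_topology A) ultra_dom ultra_act"
proof
  fix g assume g: "g \<in> carrier G"
  show "openin (stone_topology A) (ultra_dom g)" by (rule openin_ultra_dom)
  have "homeomorphic_maps (subtopology (stone_topology A) (ultra_dom (inv g)))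
      (subtopology (stone_topology A) (ultra_dom g)) (ultra_act g) (ultra_act (inv g))"
    unfolding homeomorphic_maps_def
    using continuous_ultra_act[OF g] continuous_ultra_act[of "inv g"]
      ultra_act_inverse[OF g] ultra_act_inverse[of "inv g"] g
    by auto
  then show "homeomorphic_map (subtopology (stone_topology A) (ultra_dom (inv g)))
      (subtopology (stone_topology A) (ultra_dom g)) (ultra_act g)"
    by (rule homeomorphic_maps_imp_map)
next
  have "{x \<in> A. \<one> \<otimes> x \<in> A} = A" using subset by auto
  then show "ultra_dom \<one> = topspace (stone_topology A)"
    using ultrafilter_whole by (auto simp: ultra_dom_def ultra_basic_def topspace_stone_topology)
next
  show "ultra_act \<one> p = p" if "p \<in> topspace (stone_topology A)" for p
    using that ultra_act_one by (simp add: topspace_stone_topology)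
qed (fact ultra_act_comp)+

text \<open>This transfers invariance from ultrafilters to subsets of \<open>A\<close>. The basic
  set of \<open>E\<close> lies wholly in the domain, so the intersection there cuts nothing off;
  surjectivity comes from pulling back by \<open>inv g\<close>.\<close>

lemma ultra_act_basic:
  assumes g: "g \<in> carrier G" and E: "E \<subseteq> A" "g <# E \<subseteq> A"
  shows "ultra_act g ` (ultra_basic A E \<inter> ultra_dom (inv g)) = ultra_basic A (g <# E)"
    and "ultra_basic A E \<subseteq> ultra_dom (inv g)"
proof -
  have mem: "g \<otimes> x \<in> g <# E" if "x \<in> E" for x using that by (auto simp: l_coset_def)
  have meminv: "inv g \<otimes> y \<in> E" if y: "y \<in> g <# E" for y
  proof -
    obtain x where "x \<in> E" "y = g \<otimes> x" using y by (auto simp: l_coset_def)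
    then show ?thesis using inv_mult_cancel[OF g, of x] E(1) by auto
  qed
  show sub: "ultra_basic A E \<subseteq> ultra_dom (inv g)"
  proof
    fix p assume p: "p \<in> ultra_basic A E"
    then have "{x \<in> A. g \<otimes> x \<in> A} \<in> p"
      using E mem by - (rule ultrafilter_mono[of p A E], auto simp: ultra_basic_def)
    then show "p \<in> ultra_dom (inv g)" using p by (simp add: ultra_dom_inv g ultra_basic_def)
  qed
  show "ultra_act g ` (ultra_basic A E \<inter> ultra_dom (inv g)) = ultra_basic A (g <# E)"
  proof (intro equalityI subsetI)
    fix q assume "q \<in> ultra_act g ` (ultra_basic A E \<inter> ultra_dom (inv g))"
    then obtain p where p: "p \<in> ultra_basic A E" "p \<in> ultra_dom (inv g)" "q = ultra_act g p" by auto
    have "{x \<in> A. g \<otimes> x \<in> g <# E} \<in> p"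
      using p(1) E mem by - (rule ultrafilter_mono[of p A E], auto simp: ultra_basic_def)
    then show "q \<in> ultra_basic A (g <# E)"
      using p(3) E(2) ultra_act_ultrafilter[OF g p(2)] by (simp add: ultra_basic_def ultra_act_def)
  next
    fix q assume "q \<in> ultra_basic A (g <# E)"
    then have q: "q \<in> ultrafilters_on A" "g <# E \<in> q" by (simp_all add: ultra_basic_def)
    have "{x \<in> A. inv g \<otimes> x \<in> A} \<in> q"
      using E meminv by (intro ultrafilter_mono[OF q]) auto
    then have qd: "q \<in> ultra_dom (inv (inv g))"
      using q(1) g by (subst ultra_dom_inv[of "inv g"]) simp_all
    have "{x \<in> A. inv g \<otimes> x \<in> E} \<in> q"
      using E meminv by (intro ultrafilter_mono[OF q]) auto
    then have qE: "ultra_act (inv g) q \<in> ultra_basic A E"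
      using ultra_act_ultrafilter[OF _ qd] g E(1) by (simp add: ultra_basic_def ultra_act_def)
    have "q = ultra_act g (ultra_act (inv g) q)"
      using ultra_act_inverse[OF _ qd] g by simp
    then show "q \<in> ultra_act g ` (ultra_basic A E \<inter> ultra_dom (inv g))"
      using qE sub by (intro image_eqI) auto
  qed
qed

section \<open>From invariant probabilities to supramenability\<close>

lemma invariant_prob_imp_normalized_measure:
  assumes "partial_actions_have_invariant_prob G (stone_topology A)"
  shows "\<exists>\<mu> :: 'g set \<Rightarrow> ennreal.
    positive (Pow (carrier G)) \<mu> \<and> Measure_Space.additive (Pow (carrier G)) \<mu> \<and>
    (\<forall>g\<in>carrier G. \<forall>E. E \<subseteq> carrier G \<longrightarrow> \<mu> (g <# E) = \<mu> E) \<and> \<mu> A = 1"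
proof -
  obtain \<nu> where \<nu>: "sets \<nu> = sets (borel_of_topology (stone_topology A))" "prob_space \<nu>"
    "invariant_measure G ultra_dom ultra_act \<nu>"
    using assms partial_action_stone unfolding partial_actions_have_invariant_prob_def by metis
  have space: "space \<nu> = ultrafilters_on A"
    using sets_eq_imp_space_eq[OF \<nu>(1)] by (simp add: space_borel_of_topology topspace_stone_topology)
  have meas: "ultra_basic A E \<in> sets \<nu>" for E
    using openin_ultra_basic[of A E] by (auto simp: \<nu>(1) sets_borel_of_topology)
  define m where "m E = emeasure \<nu> (ultra_basic A E)" for E
  interpret partially_invariant_content G A m
  proof
    show "A \<subseteq> carrier G" by (rule subset)
    have "ultra_basic A {} = {}" using ultrafilter_empty by (auto simp: ultra_basic_def)
    then show "positive (Pow A) m" by (simp add: positive_def m_def)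
    show "Measure_Space.additive (Pow A) m"
      unfolding additive_def
    proof (intro ballI impI)
      fix E F assume EF: "E \<in> Pow A" "F \<in> Pow A" "E \<inter> F = {}"
      have "ultra_basic A (E \<union> F) = ultra_basic A E \<union> ultra_basic A F"
        using EF by (auto simp: ultra_basic_def ultrafilter_disj)
      moreover have "ultra_basic A E \<inter> ultra_basic A F = {}"
        using ultrafilter_Int[of _ A E F] ultrafilter_empty EF(3) by (auto simp: ultra_basic_def)
      ultimately show "m (E \<union> F) = m E + m F"
        unfolding m_def using plus_emeasure[OF meas[of E] meas[of F]] by simp
    qed
    fix g E assume g: "g \<in> carrier G" and E: "E \<subseteq> A" "g <# E \<subseteq> A"
    have "emeasure \<nu> (ultra_act g ` (ultra_basic A E \<inter> ultra_dom (inv g)))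
        = emeasure \<nu> (ultra_basic A E \<inter> ultra_dom (inv g))"
      using \<nu>(3) g meas unfolding invariant_measure_def by simp
    then show "m (g <# E) = m E"
      unfolding m_def ultra_act_basic(1)[OF g E] using ultra_act_basic(2)[OF g E]
      by (simp add: Int_absorb2)
  qed
  have "ultra_basic A A = space \<nu>"
    using ultrafilter_whole by (auto simp: space ultra_basic_def)
  then have "m A = 1" using prob_space.emeasure_space_1[OF \<nu>(2)] by (simp add: m_def)
  then show ?thesis
    using extension_empty extension_additive extension_translate extension_self
    by (intro exI[of _ extension]) (simp add: positive_def)
qed

end

theorem proposition2p7:
  fixes G :: "('g, 'm) monoid_scheme"
  assumes "group G"
  shows "(supramenable G \<longleftrightarrow>
            (\<forall>X :: 'g set set topology.
               compact_space X \<and> Hausdorff_space X \<and> topspace X \<noteq> {} \<longrightarrow>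
               partial_actions_have_invariant_prob G X)) \<and>
         (supramenable G \<longrightarrow>
            (\<forall>X :: 'x topology.
               compact_space X \<and> Hausdorff_space X \<and> topspace X \<noteq> {} \<longrightarrow>
               partial_actions_have_invariant_prob G X))"
proof -
  have "supramenable G" if prob: "\<forall>X :: 'g set set topology.
      compact_space X \<and> Hausdorff_space X \<and> topspace X \<noteq> {} \<longrightarrow> partial_actions_have_invariant_prob G X"
    unfolding supramenable_def
  proof (intro allI impI)
    fix A assume A: "A \<subseteq> carrier G \<and> A \<noteq> {}"
    then have "topspace (stone_topology A) \<noteq> {}"
      using ultrafilters_on_nonempty[of A] unfolding topspace_stone_topology by blast
    \<comment> \<open>The ultrafilters on \<open>A\<close> are points of type
      \<open>'g set set\<close>, so \<open>prob\<close> covers this space.\<close>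
    then have "partial_actions_have_invariant_prob G (stone_topology A)"
      using prob compact_stone_topology[of A] Hausdorff_stone_topology[of A] by blast
    moreover have "group_subset G A"
      using A assms by (simp add: group_subset_def group_subset_axioms_def)
    ultimately show "\<exists>\<mu> :: 'g set \<Rightarrow> ennreal.
          positive (Pow (carrier G)) \<mu> \<and>
          Measure_Space.additive (Pow (carrier G)) \<mu> \<and>
          (\<forall>g\<in>carrier G. \<forall>E. E \<subseteq> carrier G \<longrightarrow> \<mu> (g <#\<^bsub>G\<^esub> E) = \<mu> E) \<and>
          \<mu> A = 1"
      by (rule group_subset.invariant_prob_imp_normalized_measure[rotated])
  qed
  then show ?thesis
    by (intro conjI iffI allI impI) (auto intro: supramenable_imp_invariant_prob)
qed

end
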